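(* Let $n$ and $m$ be positive integers. For all nonnegative integers $d_1,\dots,d_{n-1}$, \[ |\mathrm{SB}(n,m;d_1,\dots,d_{n-1})| = \left(1!\,2!\cdots (n-1)!\right)^m \cdot |\mathrm{YB}(n,m;d_1,\dots,d_{n-1})|, \] and consequently \[ |\mathrm{SB}(n,m)| = \left(1!\,2!\cdots (n-1)!\right)^m \cdot |\mathrm{YB}(n,m)|. \]
   Context: The shifted staircase of size $n$ is the set of cells $(i,j)$ (row $i$, column $j$) with $1\le i\le j\le n$; the cell $(i,i)$ is its $i$th diagonal cell. Take $m$ copies $\lambda^{(1)},\dots,\lambda^{(m)}$ (called pages) of the shifted staircase of size $n$, and for each $1\le i\le n$ identify the $i$th diagonal cells of all pages into one cell; the result has $n+m\binom n2$ cells. An $(n,m)$-Selberg book is a filling of these cells with the integers $1,2,\dots,n+m\binom n2$, each used exactly once, such that in each page, the entry of every cell $(i,j)$ with $i<j$ is larger than the entry of the $i$th diagonal cell and smaller than the entry of the $j$th diagonal cell. An $(n,m)$-Young book is an $(n,m)$-Selberg book in which, additionally, in each page the entries increase from left to right along each row and from top to bottom along each column. $\mathrm{SB}(n,m)$ and $\mathrm{YB}(n,m)$ denote the sets of $(n,m)$-Selberg books and $(n,m)$-Young books. If $e_i$ denotes the entry of the $i$th diagonal cell, $\mathrm{SB}(n,m;d_1,\dots,d_{n-1})$ (resp. $\mathrm{YB}(n,m;d_1,\dots,d_{n-1})$) is the set of $(n,m)$-Selberg (resp. Young) books with $d_i=e_{i+1}-e_i-1$ for $i=1,\dots,n-1$.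 *)

theory Defs
  imports Main
begin

text \<open>Cells of an (n,m)-book: the n shared diagonal cells Diag i (1 \<le> i \<le> n),
  and the off-diagonal cells Off k i j of page k (1 \<le> k \<le> m, 1 \<le> i < j \<le> n).\<close>

datatype cell = Diag nat | Off nat nat nat

definition book_cells :: "nat \<Rightarrow> nat \<Rightarrow> cell set" where
  "book_cells n m = Diag ` {1..n} \<union>
     {Off k i j | k i j. 1 \<le> k \<and> k \<le> m \<and> 1 \<le> i \<and> i < j \<and> j \<le> n}"

definition page_entry :: "(cell \<Rightarrow> nat) \<Rightarrow> nat \<Rightarrow> nat \<Rightarrow> nat \<Rightarrow> nat" where
  "page_entry T k i j = (if i = j then T (Diag i) else T (Off k i j))"

text \<open>A filling is a function on cells, bijective onto {1..n + m*(n choose 2)},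
  and (for extensionality) equal to 0 outside the cells.\<close>
definition selberg_book :: "nat \<Rightarrow> nat \<Rightarrow> (cell \<Rightarrow> nat) \<Rightarrow> bool" where
  "selberg_book n m T \<longleftrightarrow>
     bij_betw T (book_cells n m) {1..n + m * (n choose 2)} \<and>
     (\<forall>c. c \<notin> book_cells n m \<longrightarrow> T c = 0) \<and>
     (\<forall>k i j. 1 \<le> k \<and> k \<le> m \<and> 1 \<le> i \<and> i < j \<and> j \<le> n \<longrightarrow>
        T (Diag i) < T (Off k i j) \<and> T (Off k i j) < T (Diag j))"

definition young_book :: "nat \<Rightarrow> nat \<Rightarrow> (cell \<Rightarrow> nat) \<Rightarrow> bool" where
  "young_book n m T \<longleftrightarrow> selberg_book n m T \<and>
     (\<forall>k i j j'. 1 \<le> k \<and> k \<le> m \<and> 1 \<le> i \<and> i \<le> j \<and> j < j' \<and> j' \<le> n \<longrightarrow>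
        page_entry T k i j < page_entry T k i j') \<and>
     (\<forall>k i i' j. 1 \<le> k \<and> k \<le> m \<and> 1 \<le> i \<and> i < i' \<and> i' \<le> j \<and> j \<le> n \<longrightarrow>
        page_entry T k i j < page_entry T k i' j)"

definition SB :: "nat \<Rightarrow> nat \<Rightarrow> (cell \<Rightarrow> nat) set" where
  "SB n m = {T. selberg_book n m T}"

definition YB :: "nat \<Rightarrow> nat \<Rightarrow> (cell \<Rightarrow> nat) set" where
  "YB n m = {T. young_book n m T}"

definition diag_gaps_are :: "nat \<Rightarrow> (nat \<Rightarrow> nat) \<Rightarrow> (cell \<Rightarrow> nat) \<Rightarrow> bool" where
  "diag_gaps_are n d T \<longleftrightarrow>
     (\<forall>i. 1 \<le> i \<and> i \<le> n - 1 \<longrightarrow>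
        int (d i) = int (T (Diag (i + 1))) - int (T (Diag i)) - 1)"

definition SBd :: "nat \<Rightarrow> nat \<Rightarrow> (nat \<Rightarrow> nat) \<Rightarrow> (cell \<Rightarrow> nat) set" where
  "SBd n m d = {T \<in> SB n m. diag_gaps_are n d T}"

definition YBd :: "nat \<Rightarrow> nat \<Rightarrow> (nat \<Rightarrow> nat) \<Rightarrow> (cell \<Rightarrow> nat) set" where
  "YBd n m d = {T \<in> YB n m. diag_gaps_are n d T}"

end

theory Submission
  imports Defs "Jordan_Normal_Form.Determinant" "HOL-Library.Poly_Mapping"
begin

text \<open>Fix the diagonal entries and the entries of all pages but one; it suffices to compare the
  Selberg and the Young fillings of that page with a given set A of entries. Both are counted by
  inserting the elements of A in increasing order. For Selberg fillings this reads off, up to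
  factorials, coefficients of the product of all x j - x i with i < j, where x j stands for the
  elements of A below the j-th diagonal entry; for Young fillings the partially filled columns
  form a system of non-colliding particles, whose count is an alternating sum over permutations.
  Expanding the Vandermonde product into its own alternating sum, the two agree term by term up
  to the product of the factorials of the exponents 0, ..., n - 1.\<close>


section \<open>The Vandermonde identity as an identity of linear functionals\<close>

text \<open>Let \<open>e i\<close> be the diagonal entries. Since \<open>e\<close> increases, the
  condition e i < a < e j on an entry a of cell (i, j) has the indicator [a < e j] - [a < e i]. This
  is D_a (x j - x i) for the derivation D_a that sums d/dx i over all i with a < e i. By the product
  rule, applying D_a for every a in A to the product of all x j - x i fills the cells one by one,
  and evaluation at 0 gives the number of Selberg fillings. On a monomial with exponents c the same
  operators give the product of the c i! times the number of ways to choose for every a an index i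
  with a < e i, each i being used c i times. In the Vandermonde determinant every exponent vector is
  a permutation of 0, ..., n - 1, which makes the factorials a common factor. Only this linear
  functional matters, so it is encoded by its values on monomials,
  \<open>weighted_path_count\<close>. Such choices know only the upper bounds a < e i. On the Young
  side the lower bounds come from non-collision: a completed column i stays in the system until e i
  has passed and blocks the last cell of column i + 1.\<close>

fun newton_coeff :: "(nat \<Rightarrow> 'a::comm_ring_1) \<Rightarrow> nat \<Rightarrow> nat \<Rightarrow> 'a" where
  "newton_coeff x 0 k = (if k = 0 then 1 else 0)"
| "newton_coeff x (Suc j) k =
     x k * newton_coeff x j k + (if k = 0 then 0 else newton_coeff x j (k - 1))"

lemma newton_coeff_eq_0: "j < k \<Longrightarrow> newton_coeff x j k = 0"
  by (induction j arbitrary: k) auto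

lemma newton_coeff_diag: "newton_coeff x j j = 1"
  by (induction j) (auto simp: newton_coeff_eq_0)

text \<open>Multiplying a Newton polynomial by y gives the next one plus \<open>x k\<close> times
  itself, which is the recursion of \<open>newton_coeff\<close>. The coefficients are the complete
  homogeneous symmetric polynomials of degree j - k in x 0, ..., x k.\<close>

lemma power_newton_expansion:
  fixes x :: "nat \<Rightarrow> 'a::comm_ring_1"
  shows "y ^ j = (\<Sum>k\<le>j. (\<Prod>l<k. y - x l) * newton_coeff x j k)"
proof (induction j)
  case (Suc j)
  let ?N = "\<lambda>k. \<Prod>l<k. y - x l"
  have step: "y * ?N k = ?N (Suc k) + x k * ?N k" for k
    by (simp add: algebra_simps)
  have "y ^ Suc j = (\<Sum>k\<le>j. (y * ?N k) * newton_coeff x j k)"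
    by (simp add: Suc sum_distrib_left mult.assoc)
  also have "\<dots> = (\<Sum>k\<le>j. ?N (Suc k) * newton_coeff x j k) +
      (\<Sum>k\<le>j. ?N k * (x k * newton_coeff x j k))"
    unfolding step by (simp only: distrib_right sum.distrib mult.assoc mult.left_commute)
  also have "(\<Sum>k\<le>j. ?N (Suc k) * newton_coeff x j k) =
      (\<Sum>k\<le>Suc j. ?N k * (if k = 0 then 0 else newton_coeff x j (k - 1)))"
    by (subst sum.atMost_Suc_shift) simp
  also have "(\<Sum>k\<le>j. ?N k * (x k * newton_coeff x j k)) =
      (\<Sum>k\<le>Suc j. ?N k * (x k * newton_coeff x j k))"
    by (simp add: newton_coeff_eq_0)
  finally show ?case
    by (simp only: sum.distrib [symmetric] distrib_left [symmetric] newton_coeff.simps add.commute)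
qed simp

text \<open>The matrix of powers is the lower triangular matrix of the Newton basis times the
  upper unitriangular matrix of coefficients.\<close>

lemma Vandermonde_permutation_sum:
  fixes x :: "nat \<Rightarrow> 'a::comm_ring_1"
  shows "(\<Sum>p | p permutes {0..<n}. signof p * (\<Prod>i = 0..<n. x i ^ p i)) =
    (\<Prod>j = 0..<n. \<Prod>i<j. x j - x i)"
proof -
  define V where "V = mat n n (\<lambda>(i, j). x i ^ j)"
  define N where "N = mat n n (\<lambda>(i, k). \<Prod>l<k. x i - x l)"
  define U where "U = mat n n (\<lambda>(k, j). newton_coeff x j k)"
  have carrier: "V \<in> carrier_mat n n" "N \<in> carrier_mat n n" "U \<in> carrier_mat n n"
    by (auto simp: V_def N_def U_def)
  have "V = N * U"
  proof (rule eq_matI)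
    fix i j assume "i < dim_row (N * U)" "j < dim_col (N * U)"
    then have ij: "i < n" "j < n" using carrier by auto
    have "(N * U) $$ (i, j) = (\<Sum>k = 0..<n. (\<Prod>l<k. x i - x l) * newton_coeff x j k)"
      using ij by (simp add: N_def U_def scalar_prod_def)
    also have "\<dots> = (\<Sum>k\<le>j. (\<Prod>l<k. x i - x l) * newton_coeff x j k)"
      using ij by (intro sum.mono_neutral_right) (auto simp: newton_coeff_eq_0)
    finally show "V $$ (i, j) = (N * U) $$ (i, j)"
      using ij power_newton_expansion [of "x i" j x] by (simp add: V_def)
  qed (use carrier in auto)
  then have "det V = det N * det U"
    using det_mult carrier by metis
  moreover have "det N = (\<Prod>j = 0..<n. \<Prod>i<j. x j - x i)"
  proof (subst det_lower_triangular [OF _ carrier(2)])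
    fix i j assume "i < j" "j < n"
    then show "N $$ (i, j) = 0" by (auto simp: N_def intro!: prod_zero bexI [of _ i])
  qed (simp add: prod_list_diag_prod N_def)
  moreover have "det U = 1"
    by (subst det_upper_triangular [OF _ carrier(3)])
      (auto simp: prod_list_diag_prod U_def newton_coeff_diag newton_coeff_eq_0)
  moreover have "det V = (\<Sum>p | p permutes {0..<n}. signof p * (\<Prod>i = 0..<n. x i ^ p i))"
    unfolding det_def' [OF carrier(1)] by (intro sum.cong) (auto simp: V_def permutes_in_image intro!: prod.cong)
  ultimately show ?thesis by simp
qed

text \<open>Monomials are linearly independent, so an identity between polynomials may be evaluated
  under an arbitrary assignment F of integers to monomials.\<close>

lemma sum_single_eq_imp_functional_eq:
  fixes F :: "'k \<Rightarrow> 'a::comm_ring_1"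
  assumes fin: "finite A" "finite B"
    and eq: "(\<Sum>f\<in>A. Poly_Mapping.single (c f) (u f)) = (\<Sum>g\<in>B. Poly_Mapping.single (d g) (v g))"
  shows "(\<Sum>f\<in>A. u f * F (c f)) = (\<Sum>g\<in>B. v g * F (d g))"
proof -
  define K where "K = c ` A \<union> d ` B"
  have K: "finite K" using fin by (simp add: K_def)
  have sum_over: "(\<Sum>f\<in>A. u f * F (c f)) =
      (\<Sum>k\<in>K. Poly_Mapping.lookup (\<Sum>f\<in>A. Poly_Mapping.single (c f) (u f)) k * F k)"
    if "c ` A \<subseteq> K" for A :: "'z set" and c u
  proof -
    have "(\<Sum>k\<in>K. Poly_Mapping.lookup (\<Sum>f\<in>A. Poly_Mapping.single (c f) (u f)) k * F k) =
        (\<Sum>f\<in>A. \<Sum>k\<in>K. if c f = k then u f * F k else 0)"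
      by (subst sum.swap)
        (auto intro!: sum.cong simp: Poly_Mapping.lookup_sum sum_distrib_right lookup_single when_def)
    also have "\<dots> = (\<Sum>f\<in>A. u f * F (c f))"
      using K that by (intro sum.cong) auto
    finally show ?thesis ..
  qed
  show ?thesis
    using sum_over [of c A u] sum_over [of d B v] by (simp add: K_def eq)
qed

section \<open>Counting fillings by inserting the least entry\<close>

text \<open>T0 prescribes all cells outside the page, so filling one position just moves it from Q
  into the background T0. The diagonal cells act through \<open>lo\<close> and \<open>hi\<close>;
  Selberg and Young pages differ only in R.\<close>

definition fillings ::
  "('q \<Rightarrow> 'a) \<Rightarrow> ('q \<Rightarrow> 'q \<Rightarrow> bool) \<Rightarrow> ('q \<Rightarrow> nat) \<Rightarrow> ('q \<Rightarrow> nat) \<Rightarrow>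
    ('a \<Rightarrow> nat) \<Rightarrow> 'q set \<Rightarrow> nat set \<Rightarrow> ('a \<Rightarrow> nat) set" where
  "fillings \<iota> R lo hi T0 Q A = {T. (\<forall>c. c \<notin> \<iota> ` Q \<longrightarrow> T c = T0 c) \<and> bij_betw (T \<circ> \<iota>) Q A \<and>
     (\<forall>q\<in>Q. lo q < T (\<iota> q) \<and> T (\<iota> q) < hi q) \<and>
     (\<forall>p\<in>Q. \<forall>q\<in>Q. R p q \<longrightarrow> T (\<iota> p) < T (\<iota> q))}"

fun filling_count ::
  "('q \<Rightarrow> 'q \<Rightarrow> bool) \<Rightarrow> ('q \<Rightarrow> nat) \<Rightarrow> ('q \<Rightarrow> nat) \<Rightarrow> nat list \<Rightarrow> 'q set \<Rightarrow> nat" where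
  "filling_count R lo hi [] Q = (if Q = {} then 1 else 0)"
| "filling_count R lo hi (a # as) Q =
     (\<Sum>q | q \<in> Q \<and> lo q < a \<and> a < hi q \<and> (\<forall>p\<in>Q. \<not> R p q). filling_count R lo hi as (Q - {q}))"

lemma finite_fillings:
  assumes "finite Q" "finite A"
  shows "finite (fillings \<iota> R lo hi T0 Q A)"
proof (rule finite_subset)
  let ?m = "\<lambda>g c. if c \<in> \<iota> ` Q then g (inv_into Q \<iota> c) else T0 c"
  show "fillings \<iota> R lo hi T0 Q A \<subseteq> ?m ` (Q \<rightarrow>\<^sub>E A)"
  proof
    fix T assume "T \<in> fillings \<iota> R lo hi T0 Q A"
    then have T: "\<forall>c. c \<notin> \<iota> ` Q \<longrightarrow> T c = T0 c" "bij_betw (T \<circ> \<iota>) Q A"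
      by (auto simp: fillings_def)
    have "T = ?m (restrict (T \<circ> \<iota>) Q)"
      using T(1) by (auto simp: fun_eq_iff f_inv_into_f inv_into_into)
    moreover have "restrict (T \<circ> \<iota>) Q \<in> Q \<rightarrow>\<^sub>E A"
      using T(2) by (auto simp: bij_betw_def)
    ultimately show "T \<in> ?m ` (Q \<rightarrow>\<^sub>E A)" by blast
  qed
  show "finite (?m ` (Q \<rightarrow>\<^sub>E A))"
    using assms by (simp add: finite_PiE)
qed

text \<open>The least entry respects every constraint \<open>R q p\<close> automatically and
  violates every \<open>R p q\<close>, so only an R-minimal q can carry it. The other entries then
  form a filling with a absorbed into T0.\<close>

lemma fillings_fix_least:
  assumes inj: "inj_on \<iota> Q" and q: "q \<in> Q" and a: "a \<notin> A" "\<And>b. b \<in> A \<Longrightarrow> a < b"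
    and R: "\<not> R q q"
  shows "{T \<in> fillings \<iota> R lo hi T0 Q (insert a A). T (\<iota> q) = a} =
    (if lo q < a \<and> a < hi q \<and> (\<forall>p\<in>Q. \<not> R p q)
     then fillings \<iota> R lo hi (T0(\<iota> q := a)) (Q - {q}) A else {})"
    (is "?L = ?R")
proof -
  have bij_iff: "bij_betw (T \<circ> \<iota>) Q (insert a A) \<longleftrightarrow> bij_betw (T \<circ> \<iota>) (Q - {q}) A"
    if "T (\<iota> q) = a" for T
    using notIn_Un_bij_betw3 [of q "Q - {q}" "T \<circ> \<iota>" A] q a(1) that
    by (simp add: insert_absorb)
  have outside: "c \<notin> \<iota> ` (Q - {q}) \<longleftrightarrow> c \<notin> \<iota> ` Q \<or> c = \<iota> q" for c
    using inj q by (auto simp: inj_on_def)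
  have above: "a < T (\<iota> p)" if "bij_betw (T \<circ> \<iota>) (Q - {q}) A" "p \<in> Q" "p \<noteq> q" for T p
    using that a(2) by (auto simp: bij_betw_def)
  show ?thesis
  proof (intro Set.set_eqI iffI)
    fix T assume T: "T \<in> ?L"
    then have Tq: "T (\<iota> q) = a" and "bij_betw (T \<circ> \<iota>) Q (insert a A)"
      by (auto simp: fillings_def)
    then have bij: "bij_betw (T \<circ> \<iota>) (Q - {q}) A"
      by (simp add: bij_iff)
    have "\<not> R p q" if "p \<in> Q" for p
      using T that q R above [OF bij, of p] by (cases "p = q") (fastforce simp: fillings_def)+
    then show "T \<in> ?R"
      using T q bij by (auto simp: fillings_def outside)
  next
    fix T assume T: "T \<in> ?R"
    then have ok: "lo q < a" "a < hi q" "\<And>p. p \<in> Q \<Longrightarrow> \<not> R p q"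
      and T': "T \<in> fillings \<iota> R lo hi (T0(\<iota> q := a)) (Q - {q}) A"
      by (auto split: if_splits)
    have Tq: "T (\<iota> q) = a" and bij: "bij_betw (T \<circ> \<iota>) (Q - {q}) A"
      using T' by (auto simp: fillings_def outside)
    have "T (\<iota> p) < T (\<iota> p')" if "p \<in> Q" "p' \<in> Q" "R p p'" for p p'
      using T' that ok(3) Tq above [OF bij, of p'] R
      by (cases "p = q"; cases "p' = q") (auto simp: fillings_def)
    moreover have "lo p < T (\<iota> p) \<and> T (\<iota> p) < hi p" if "p \<in> Q" for p
      using T' that ok Tq by (cases "p = q") (auto simp: fillings_def)
    moreover have "T c = T0 c" if "c \<notin> \<iota> ` Q" for c
      using T' that q by (auto simp: fillings_def outside)
    ultimately show "T \<in> ?L"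
      using Tq bij bij_iff [of T] by (auto simp: fillings_def)
  qed
qed

lemma card_fillings:
  assumes "finite Q" "inj_on \<iota> Q" "sorted_wrt (<) as" "\<And>q. \<not> R q q"
  shows "card (fillings \<iota> R lo hi T0 Q (set as)) = filling_count R lo hi as Q"
  using assms
proof (induction as arbitrary: Q T0)
  case Nil
  show ?case
  proof (cases "Q = {}")
    case True
    then have "fillings \<iota> R lo hi T0 Q (set []) = {T0}" by (auto simp: fillings_def bij_betw_def)
    then show ?thesis using True by simp
  next
    case False
    then have "fillings \<iota> R lo hi T0 Q (set []) = {}" by (auto simp: fillings_def bij_betw_def)
    then show ?thesis using False by simp
  qed
next
  case (Cons a as)
  let ?F = "fillings \<iota> R lo hi T0 Q (set (a # as))"
  let ?ok = "\<lambda>q. lo q < a \<and> a < hi q \<and> (\<forall>p\<in>Q. \<not> R p q)"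
  have least: "a \<notin> set as" "\<And>b. b \<in> set as \<Longrightarrow> a < b"
    using Cons.prems(3) by auto
  have fix_q: "card {T \<in> ?F. T (\<iota> q) = a} =
      (if ?ok q then filling_count R lo hi as (Q - {q}) else 0)" if "q \<in> Q" for q
    using fillings_fix_least [OF Cons.prems(2) that least, where R = R and lo = lo and hi = hi and ?T0.0 = T0]
      Cons.IH [of "Q - {q}"] Cons.prems by (auto simp: inj_on_diff)
  have "?F = (\<Union>q\<in>Q. {T \<in> ?F. T (\<iota> q) = a})"
  proof -
    have "\<exists>q\<in>Q. T (\<iota> q) = a" if "T \<in> ?F" for T
    proof -
      have "a \<in> (T \<circ> \<iota>) ` Q"
        using that by (auto simp: fillings_def bij_betw_def)
      then show ?thesis by auto
    qed
    then show ?thesis by blast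
  qed
  then have "card ?F = card (\<Union>q\<in>Q. {T \<in> ?F. T (\<iota> q) = a})"
    by simp
  also have "\<dots> = (\<Sum>q\<in>Q. card {T \<in> ?F. T (\<iota> q) = a})"
  proof (rule card_UN_disjoint)
    show "\<forall>q\<in>Q. finite {T \<in> ?F. T (\<iota> q) = a}"
    proof
      have "finite ?F" by (rule finite_fillings [OF Cons.prems(1) finite_set])
      then show "finite {T \<in> ?F. T (\<iota> q) = a}" for q by (rule rev_finite_subset) blast
    qed
    show "\<forall>p\<in>Q. \<forall>q\<in>Q. p \<noteq> q \<longrightarrow> {T \<in> ?F. T (\<iota> p) = a} \<inter> {T \<in> ?F. T (\<iota> q) = a} = {}"
    proof (intro ballI impI)
      fix p q assume pq: "p \<in> Q" "q \<in> Q" "p \<noteq> q"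
      have "\<not> (T (\<iota> p) = a \<and> T (\<iota> q) = a)" if "T \<in> ?F" for T
        using that pq unfolding fillings_def bij_betw_def inj_on_def by auto
      then show "{T \<in> ?F. T (\<iota> p) = a} \<inter> {T \<in> ?F. T (\<iota> q) = a} = {}"
        by blast
    qed
  qed fact
  also have "\<dots> = (\<Sum>q\<in>Q. if ?ok q then filling_count R lo hi as (Q - {q}) else 0)"
    using fix_q by simp
  also have "\<dots> = filling_count R lo hi (a # as) Q"
    using Cons.prems(1) by (simp add: sum.inter_filter)
  finally show ?case .
qed

lemma filling_count_eq_0:
  assumes "finite Q" "q \<in> Q" "\<And>a. a \<in> set as \<Longrightarrow> hi q < a"
  shows "filling_count R lo hi as Q = 0"
  using assms
proof (induction as arbitrary: Q)
  case (Cons a as)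
  have "filling_count R lo hi as (Q - {p}) = 0" if "a < hi p" for p
    using Cons that by (metis DiffI finite_Diff list.set_intros order_less_asym singletonD)
  then show ?case by simp
qed auto

section \<open>Young fillings as an alternating sum\<close>

text \<open>The number of ways to assign to every entry a an index i with a < e i so that each index
  i < n is used c i times.\<close>

fun path_count :: "nat \<Rightarrow> (nat \<Rightarrow> nat) \<Rightarrow> nat list \<Rightarrow> (nat \<Rightarrow> nat) \<Rightarrow> nat" where
  "path_count n e [] c = (if \<forall>i<n. c i = 0 then 1 else 0)"
| "path_count n e (a # as) c =
     (\<Sum>i | i < n \<and> a < e i \<and> 0 < c i. path_count n e as (c(i := c i - 1)))"

lemma path_count_cong:
  assumes "\<And>i. i < n \<Longrightarrow> c i = c' i"
  shows "path_count n e as c = path_count n e as c'"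
  using assms
proof (induction as arbitrary: c c')
  case (Cons a as)
  have "path_count n e as (c(i := c i - 1)) = path_count n e as (c'(i := c' i - 1))" if "i < n" for i
    by (rule Cons.IH) (simp add: Cons.prems that)
  then show ?case
    unfolding path_count.simps using Cons.prems by (intro sum.cong Collect_cong) auto
qed auto

lemma path_count_eq_0:
  assumes "i < n" "0 < c i" "\<And>a. a \<in> set as \<Longrightarrow> e i < a"
  shows "path_count n e as c = 0"
  using assms
proof (induction as arbitrary: c)
  case (Cons a as)
  have "path_count n e as (c(j := c j - 1)) = 0" if "a < e j" for j
    using Cons that by (intro Cons.IH) (auto simp: less_not_sym)
  then show ?case by simp
qed auto

text \<open>Column i is a particle that has c i steps left and must make them before
  \<open>e i\<close>. The columns below s have passed their diagonal entry and are finished, so only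
  the active ones, in {s..<n}, are exchanged.\<close>

definition alternating_path_count ::
  "nat \<Rightarrow> (nat \<Rightarrow> nat) \<Rightarrow> nat list \<Rightarrow> nat \<Rightarrow> (nat \<Rightarrow> nat) \<Rightarrow> int" where
  "alternating_path_count n e as s c =
     (\<Sum>p | p permutes {s..<n}. sign p * int (path_count n e as (c \<circ> p)))"

text \<open>Composing p with the transposition of i and j leaves \<open>c \<circ> p\<close>
  unchanged and flips the sign, so the sum equals its own negative.\<close>

lemma alternating_path_count_repeated:
  assumes ij: "i \<in> {s..<n}" "j \<in> {s..<n}" "i \<noteq> j" "c i = c j"
  shows "alternating_path_count n e as s c = 0"
proof -
  let ?t = "transpose i j"
  let ?f = "\<lambda>p. sign p * int (path_count n e as (c \<circ> p))"
  have t: "?t permutes {s..<n}"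
    using ij by (intro permutes_swap_id) auto
  have ct: "c \<circ> (?t \<circ> p) = c \<circ> p" for p
    using ij(4) by (auto simp: fun_eq_iff transpose_def)
  have "alternating_path_count n e as s c = (\<Sum>p | p permutes {s..<n}. ?f (?t \<circ> p))"
    unfolding alternating_path_count_def by (rule setum_permutations_compose_left [OF t])
  also have "\<dots> = (\<Sum>p | p permutes {s..<n}. - ?f p)"
  proof (rule sum.cong)
    fix p assume "p \<in> {p. p permutes {s..<n}}"
    then have "sign (?t \<circ> p) = - sign p"
      using ij(3) t
      by (subst sign_compose) (auto simp: sign_swap_id permutation_permutes intro: permutation_swap_id)
    then show "?f (?t \<circ> p) = - ?f p"
      by (simp add: ct)
  qed simp
  also have "\<dots> = - alternating_path_count n e as s c"
    by (simp add: alternating_path_count_def sum_negf)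
  finally show ?thesis by simp
qed

text \<open>The indices that a may use are exactly {s..<n}, a set preserved by p. Hence a step at i
  under \<open>c \<circ> p\<close> is a step at j = p i under c, and the range of j no longer
  depends on p.\<close>

lemma alternating_path_count_Cons:
  assumes s: "\<And>i. i < n \<Longrightarrow> a < e i \<longleftrightarrow> s \<le> i"
  shows "alternating_path_count n e (a # as) s c =
    (\<Sum>j | j \<in> {s..<n} \<and> 0 < c j. alternating_path_count n e as s (c(j := c j - 1)))"
proof -
  let ?J = "{j. j \<in> {s..<n} \<and> 0 < c j}"
  have "path_count n e (a # as) (c \<circ> p) = (\<Sum>j\<in>?J. path_count n e as (c(j := c j - 1) \<circ> p))"
    if p: "p permutes {s..<n}" for p
  proof -
    have upd: "(c \<circ> p)(i := c (p i) - 1) = c(p i := c (p i) - 1) \<circ> p" for i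
      using permutes_inj [OF p] by (auto simp: fun_eq_iff inj_def)
    have "path_count n e (a # as) (c \<circ> p) =
        (\<Sum>i | i \<in> {s..<n} \<and> 0 < c (p i). path_count n e as (c(p i := c (p i) - 1) \<circ> p))"
      using s by (auto intro!: sum.cong simp: upd [symmetric] simp del: One_nat_def)
    also have "\<dots> = (\<Sum>j\<in>?J. path_count n e as (c(j := c j - 1) \<circ> p))"
      using p permutes_inv [OF p]
      by (intro sum.reindex_bij_witness [of _ "Hilbert_Choice.inv p" p])
        (auto simp: permutes_inverses permutes_in_image simp del: atLeastLessThan_iff)
    finally show ?thesis .
  qed
  then have "alternating_path_count n e (a # as) s c =
      (\<Sum>p | p permutes {s..<n}. \<Sum>j\<in>?J. sign p * int (path_count n e as (c(j := c j - 1) \<circ> p)))"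
    unfolding alternating_path_count_def
    by (intro sum.cong refl) (auto simp: sum_distrib_left simp del: path_count.simps)
  also have "\<dots> = (\<Sum>j\<in>?J. alternating_path_count n e as s (c(j := c j - 1)))"
    unfolding alternating_path_count_def by (rule sum.swap)
  finally show ?thesis .
qed

text \<open>With all entries beyond \<open>e s\<close>, index s must have no steps left. As c is
  strictly increasing, any p that moves s gives it c (p s) > c s, so only permutations fixing s
  survive, and these only if c s = 0.\<close>

lemma alternating_path_count_drop:
  assumes sn: "s < n" and above: "\<And>a. a \<in> set as \<Longrightarrow> e s < a"
    and c: "strict_mono_on {s..<n} c"
  shows "alternating_path_count n e as s c =
    (if c s = 0 then alternating_path_count n e as (Suc s) c else 0)"
proof -
  have vanish: "path_count n e as (c \<circ> p) = 0" if "0 < c (p s)" for p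
    using sn above that by (intro path_count_eq_0 [of s]) auto
  have pos: "0 < c (p s)" if "p permutes {s..<n}" "p s \<noteq> s \<or> 0 < c s" for p
  proof (cases "p s = s")
    case False
    have "p s \<in> {s..<n}" using permutes_in_image [OF that(1), of s] sn by simp
    then have "c s < c (p s)"
      using False sn by (intro strict_mono_onD [OF c]) auto
    then show ?thesis by simp
  qed (use that in auto)
  show ?thesis
  proof (cases "c s = 0")
    case True
    have "p permutes {Suc s..<n} \<longleftrightarrow> p permutes {s..<n} \<and> p s = s" for p
    proof
      assume p: "p permutes {Suc s..<n}"
      then show "p permutes {s..<n} \<and> p s = s"
        by (auto intro: permutes_subset simp: permutes_not_in)
    next
      assume p: "p permutes {s..<n} \<and> p s = s"
      show "p permutes {Suc s..<n}"
      proof (rule permutes_superset)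
        show "p permutes {s..<n}" using p by blast
        fix x assume "x \<in> {s..<n} - {Suc s..<n}"
        then have "x = s" by auto
        then show "p x = x" using p by simp
      qed
    qed
    then have "alternating_path_count n e as s c = alternating_path_count n e as (Suc s) c"
      unfolding alternating_path_count_def using pos vanish
      by (intro sum.mono_neutral_right) (auto simp: finite_permutations)
    then show ?thesis using True by simp
  next
    case False
    then show ?thesis
      using pos vanish by (auto simp: alternating_path_count_def intro!: sum.neutral)
  qed
qed

text \<open>Meant for off-diagonal cells; comparisons with the diagonal are carried by the bounds
  \<open>e \<circ> fst\<close> and \<open>e \<circ> snd\<close>.\<close>

definition young_less :: "nat \<times> nat \<Rightarrow> nat \<times> nat \<Rightarrow> bool" where
  "young_less p q \<longleftrightarrow> fst p = fst q \<and> snd p < snd q \<or> snd p = snd q \<and> fst p < fst q"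

text \<open>The cells still empty when column j (counted from 0) lacks its c j lowest off-diagonal
  entries; columns are filled from the top.\<close>

definition lower_cells :: "nat \<Rightarrow> (nat \<Rightarrow> nat) \<Rightarrow> (nat \<times> nat) set" where
  "lower_cells n c = {(i, j). i < j \<and> j < n \<and> j \<le> i + c j}"

lemma finite_lower_cells: "finite (lower_cells n c)"
  by (rule finite_subset [of _ "{..<n} \<times> {..<n}"]) (auto simp: lower_cells_def)

lemma strict_mono_on_gap:
  fixes c :: "nat \<Rightarrow> nat"
  assumes "strict_mono_on {s..<n} c" "s \<le> x" "x \<le> y" "y < n"
  shows "c x + (y - x) \<le> c y"
  using assms(3,4)
proof (induction y rule: dec_induct)
  case (step y)
  have "c y < c (Suc y)"
    using step assms(2) by (intro strict_mono_onD [OF assms(1)]) auto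
  then show ?case using step by simp
qed simp

text \<open>The topmost empty cell of column j is (j - c j, j). For j > s, its left neighbour is
  filled iff c (j - 1) < c j - 1, that is, iff lowering c j keeps c strictly increasing. If c j = 1,
  that neighbour is a diagonal cell whose entry exceeds a, and the inequality rightly fails.\<close>

lemma minimal_lower_cells:
  assumes s: "\<And>i. i < n \<Longrightarrow> e i < a \<longleftrightarrow> i < s" "\<And>i. i < n \<Longrightarrow> a < e i \<longleftrightarrow> s \<le> i"
    and c: "strict_mono_on {s..<n} c" "\<And>i. i < s \<Longrightarrow> c i = 0" "\<And>j. j < n \<Longrightarrow> c j \<le> j"
  shows "{q. q \<in> lower_cells n c \<and> e (fst q) < a \<and> a < e (snd q) \<and>
      (\<forall>p\<in>lower_cells n c. \<not> young_less p q)} =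
    (\<lambda>j. (j - c j, j)) ` {j. j \<in> {s..<n} \<and> 0 < c j \<and> (j = s \<or> c (j - 1) < c j - 1)}"
    (is "?L = ?h ` ?J")
proof (intro Set.set_eqI iffI)
  fix q assume q: "q \<in> ?L"
  obtain i j where ij: "q = (i, j)" by (cases q)
  then have mem: "i < j" "j < n" "j \<le> i + c j" and "e i < a" "a < e j"
    and min: "\<And>i' j'. i' < j' \<Longrightarrow> j' < n \<Longrightarrow> j' \<le> i' + c j' \<Longrightarrow> \<not> young_less (i', j') (i, j)"
    using q by (auto simp: lower_cells_def)
  then have is_js: "i < s" "s \<le> j" using s by auto
  have "i = j - c j"
  proof (rule ccontr)
    assume "i \<noteq> j - c j"
    then show False
      using mem c(3) [of j] min [of "i - 1" j] by (cases i; cases "j \<le> i - 1 + c j") (auto simp: young_less_def)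
  qed
  \<comment> \<open>Since i < s <= j - 1, the left neighbour (i, j - 1) is off the diagonal and must
    already be filled.\<close>
  moreover have "c (j - 1) < c j - 1" if "j \<noteq> s"
  proof -
    have "i < j - 1" "j - 1 < n"
      using that mem(2) is_js by linarith+
    then have "\<not> j - 1 \<le> i + c (j - 1)"
      using min [of i "j - 1"] by (auto simp: young_less_def)
    then show ?thesis
      using \<open>i = j - c j\<close> c(3) [of j] mem(1,2) by linarith
  qed
  moreover have "0 < c j" using mem by linarith
  ultimately show "q \<in> ?h ` ?J"
    using mem(2) is_js(2) ij by auto
next
  fix q assume "q \<in> ?h ` ?J"
  then obtain j where j: "s \<le> j" "j < n" "0 < c j" "j = s \<or> c (j - 1) < c j - 1"
    and q: "q = (j - c j, j)" by auto
  have le: "c j \<le> j" using c(3) j by simp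
  \<comment> \<open>Row x - c x is where the empty part of column x starts. Left of j it starts
    strictly below row j - c j, so no empty cell of that row precedes column j; x = s also yields
    the lower bound j - c j < s.\<close>
  have column_tops: "j - c j < x - c x" "c x \<le> x" if "s \<le> x" "x < j" for x
  proof -
    have "x \<le> j - 1" "j - 1 < n" "c (j - 1) < c j - 1" using that j by auto
    moreover show "c x \<le> x" using c(3) that j by simp
    ultimately show "j - c j < x - c x"
      using strict_mono_on_gap [OF c(1) that(1), of "j - 1"] le by linarith
  qed
  have "j - c j < s"
    using column_tops [of s] j le by (cases "j = s") auto
  moreover have "\<not> young_less (i', j') (j - c j, j)" if "i' < j'" "j' < n" "j' \<le> i' + c j'" for i' j'
  proof
    assume "young_less (i', j') (j - c j, j)"
    then consider "i' = j - c j" "j' < j" | "j' = j" "i' < j - c j"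
      by (auto simp: young_less_def)
    then show False
    proof cases
      case 1
      then show False using column_tops [of j'] c(2) [of j'] that by (cases "j' < s") auto
    next
      case 2
      then show False using that(3) le by simp
    qed
  qed
  ultimately show "q \<in> ?L"
    using j le s by (auto simp: q lower_cells_def)
qed

text \<open>The antisymmetry of the right-hand side makes all moves that break strict monotonicity
  of c cancel, as in the Lindstroem-Gessel-Viennot lemma.\<close>

lemma young_filling_count:
  assumes e: "strict_mono_on {..<n} e" and as: "sorted_wrt (<) as" "set as \<inter> e ` {..<n} = {}"
    and s: "s \<le> n" "\<And>i a. i < s \<Longrightarrow> a \<in> set as \<Longrightarrow> e i < a"
    and c: "strict_mono_on {s..<n} c" "\<And>i. i < s \<Longrightarrow> c i = 0" "\<And>j. j < n \<Longrightarrow> c j \<le> j"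
  shows "int (filling_count young_less (e \<circ> fst) (e \<circ> snd) as (lower_cells n c)) =
    alternating_path_count n e as s c"
  using as s c
proof (induction as arbitrary: s c)
  \<comment> \<open>This raises s past a diagonal entry that all remaining entries exceed. If column
    s is incomplete, its lowest cell (s - 1, s) has upper bound \<open>e s\<close> and can no longer
    be filled, so both sides vanish.\<close>
  have drop: "int (filling_count young_less (e \<circ> fst) (e \<circ> snd) as (lower_cells n c)) =
      alternating_path_count n e as s c"
    if "s < n" "\<And>i a. i < Suc s \<Longrightarrow> a \<in> set as \<Longrightarrow> e i < a"
      and c: "strict_mono_on {s..<n} c" "\<And>i. i < s \<Longrightarrow> c i = 0" "\<And>j. j < n \<Longrightarrow> c j \<le> j"
      and IH: "\<And>c. strict_mono_on {Suc s..<n} c \<Longrightarrow> (\<And>i. i < Suc s \<Longrightarrow> c i = 0) \<Longrightarrow>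
        (\<And>j. j < n \<Longrightarrow> c j \<le> j) \<Longrightarrow>
        int (filling_count young_less (e \<circ> fst) (e \<circ> snd) as (lower_cells n c)) =
        alternating_path_count n e as (Suc s) c"
    for as s c
  proof (cases "c s = 0")
    case True
    have "strict_mono_on {Suc s..<n} c"
      using c(1) by (rule monotone_on_subset) auto
    then show ?thesis
      using True that by (subst IH) (auto simp: alternating_path_count_drop less_Suc_eq)
  next
    case False
    then have "(s - 1, s) \<in> lower_cells n c"
      using that(1) c(3) [of s] by (auto simp: lower_cells_def)
    then have "filling_count young_less (e \<circ> fst) (e \<circ> snd) as (lower_cells n c) = 0"
      using that(2) by (intro filling_count_eq_0 [OF finite_lower_cells]) auto
    then show ?thesis
      using False that by (simp add: alternating_path_count_drop)
  qed
  {
    case Nil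
    from Nil(3-) show ?case
    proof (induction s arbitrary: c rule: inc_induct)
      case base
      have "lower_cells n c = {}"
        using base by (fastforce simp: lower_cells_def)
      then show ?case
        using base by (simp add: alternating_path_count_def)
    next
      case (step s)
      show ?case
        by (rule drop) (use step in auto)
    qed
  next
    case (Cons a as)
    have e_less: "e i < e j \<longleftrightarrow> i < j" if "i < n" "j < n" for i j
      using strict_mono_on_less [OF e] that by auto
    have a_ne: "a \<noteq> e i" if "i < n" for i
      using Cons.prems(2) that by auto
    \<comment> \<open>The threshold belonging to a: the first index whose diagonal entry exceeds a,
      or n if there is none. After s has been raised to t, the active columns are exactly those with
      a below their diagonal entry.\<close>
    define t where "t = (LEAST i. i = n \<or> a < e i)"
    have t_props: "t = n \<or> a < e t" "t \<le> n" "\<And>i. i < t \<Longrightarrow> i \<noteq> n \<and> \<not> a < e i"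
      unfolding t_def by (rule LeastI [of _ n], simp, rule Least_le, simp, drule not_less_Least, simp)
    have above: "a < e i \<longleftrightarrow> t \<le> i" if "i < n" for i
      using t_props that e_less [of t i] by (metis le_neq_implies_less less_le_not_le less_trans not_less)
    have below: "e i < a \<longleftrightarrow> i < t" if "i < n" for i
      using above [OF that] a_ne [OF that] by linarith
    have "s \<le> t"
      using t_props(1) Cons.prems(3,4) by (metis less_asym list.set_intros(1) not_le)
    moreover have "\<And>i b. i < t \<Longrightarrow> b \<in> set (a # as) \<Longrightarrow> e i < b"
      using below t_props(2) Cons.prems(1) by (metis less_le_trans less_trans set_ConsD sorted_wrt.simps(2))
    ultimately show ?case
      using Cons.prems(5-)
    proof (induction s arbitrary: c rule: inc_induct)
      case base
      let ?F = "\<lambda>as c. int (filling_count young_less (e \<circ> fst) (e \<circ> snd) as (lower_cells n c))"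
      let ?J = "{j. j \<in> {t..<n} \<and> 0 < c j \<and> (j = t \<or> c (j - 1) < c j - 1)}"
      have remove: "lower_cells n c - {(j - c j, j)} = lower_cells n (c(j := c j - 1))" if "j \<in> ?J" for j
        using that base(4) [of j] by (auto simp: lower_cells_def split: if_splits)
      have "?F (a # as) c = (\<Sum>j\<in>?J. ?F as (c(j := c j - 1)))"
        using minimal_lower_cells [OF below above base(2-4)]
        by (simp add: sum.reindex inj_on_def remove)
      also have "\<dots> = (\<Sum>j\<in>?J. alternating_path_count n e as t (c(j := c j - 1)))"
      proof (rule sum.cong [OF refl])
        fix j assume j: "j \<in> ?J"
        show "?F as (c(j := c j - 1)) = alternating_path_count n e as t (c(j := c j - 1))"
        proof (rule Cons.IH)
          show "strict_mono_on {t..<n} (c(j := c j - 1))"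
          proof (rule strict_mono_onI)
            fix x y assume xy: "x \<in> {t..<n}" "y \<in> {t..<n}" "x < y"
            then have "c x < c y" by (intro strict_mono_onD [OF base(2)])
            moreover have "c x < c j - 1" if "y = j"
            proof -
              have "x \<le> j - 1" "j - 1 < n" using that xy j by auto
              then show ?thesis
                using strict_mono_on_gap [OF base(2), of x "j - 1"] that xy j by auto
            qed
            ultimately show "(c(j := c j - 1)) x < (c(j := c j - 1)) y"
              using xy by auto
          qed
          show "(c(j := c j - 1)) i = 0" if "i < t" for i
            using base(3) that j by auto
          show "(c(j := c j - 1)) i \<le> i" if "i < n" for i
            using base(4) that by (auto intro: order_trans [OF diff_le_self])
          show "sorted_wrt (<) as" "set as \<inter> e ` {..<n} = {}" "t \<le> n"
            using Cons.prems(1,2) t_props(2) by auto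
          show "e i < b" if "i < t" "b \<in> set as" for i b
            using base(1) [of i b] that by simp
        qed
      qed
      also have "\<dots> = (\<Sum>j | j \<in> {t..<n} \<and> 0 < c j. alternating_path_count n e as t (c(j := c j - 1)))"
      proof (rule sum.mono_neutral_left)
        show "\<forall>j\<in>{j. j \<in> {t..<n} \<and> 0 < c j} - ?J.
            alternating_path_count n e as t (c(j := c j - 1)) = 0"
        proof
          \<comment> \<open>Here j > t, so j - 1 is active too. Strictness leaves c (j - 1) = c j -
            1 as the only way to fail, and the step makes the two values equal.\<close>
          fix j assume j: "j \<in> {j. j \<in> {t..<n} \<and> 0 < c j} - ?J"
          then have "c (j - 1) < c j"
            by (intro strict_mono_onD [OF base(2)]) auto
          then have "c (j - 1) = c j - 1" "j - 1 \<noteq> j" using j by auto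
          then show "alternating_path_count n e as t (c(j := c j - 1)) = 0"
            using j by (intro alternating_path_count_repeated [of "j - 1" _ _ j]) auto
        qed
      qed auto
      also have "\<dots> = alternating_path_count n e (a # as) t c"
        using above by (rule alternating_path_count_Cons [symmetric])
      finally show ?case .
    next
      case (step s)
      show ?case
      proof (rule drop)
        fix c :: "nat \<Rightarrow> nat"
        assume "strict_mono_on {Suc s..<n} c" "\<And>i. i < Suc s \<Longrightarrow> c i = 0" "\<And>j. j < n \<Longrightarrow> c j \<le> j"
        with step.prems(1) show "int (filling_count young_less (e \<circ> fst) (e \<circ> snd) (a # as) (lower_cells n c)) =
            alternating_path_count n e (a # as) (Suc s) c"
          by (rule step.IH)
      qed (use step.hyps step.prems t_props(2) in auto)
    qed
  }
qed

section \<open>Selberg fillings as an alternating sum\<close>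

definition weighted_path_count :: "nat \<Rightarrow> (nat \<Rightarrow> nat) \<Rightarrow> nat list \<Rightarrow> (nat \<Rightarrow> nat) \<Rightarrow> nat" where
  "weighted_path_count n e as c = (\<Prod>i<n. fact (c i)) * path_count n e as c"

lemma weighted_path_count_cong:
  assumes "\<And>i. i < n \<Longrightarrow> c i = c' i"
  shows "weighted_path_count n e as c = weighted_path_count n e as c'"
  unfolding weighted_path_count_def using assms path_count_cong [of n c c' e as] by simp

text \<open>The factorials turn the guard 0 < c i into the factor c i, as in differentiating the
  power x i ^ c i.\<close>

lemma weighted_path_count_Cons:
  "weighted_path_count n e (a # as) c =
    (\<Sum>i | i < n \<and> a < e i. c i * weighted_path_count n e as (c(i := c i - 1)))"
proof -
  have summand: "(\<Prod>j<n. fact (c j)) * path_count n e as (c(i := c i - 1)) =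
      c i * weighted_path_count n e as (c(i := c i - 1))" if "i < n" "0 < c i" for i
  proof -
    have "(\<Prod>j<n. fact (c j)) = fact (c i) * (\<Prod>j\<in>{..<n} - {i}. fact (c j) :: nat)"
      using that by (subst prod.remove [of _ i]) auto
    moreover have "(\<Prod>j<n. fact ((c(i := c i - 1)) j)) =
        fact (c i - 1) * (\<Prod>j\<in>{..<n} - {i}. fact (c j) :: nat)"
      using that by (subst prod.remove [of _ i]) auto
    moreover have "fact (c i) = c i * (fact (c i - 1) :: nat)"
      using that by (simp add: fact_reduce)
    ultimately show ?thesis
      by (simp add: weighted_path_count_def)
  qed
  have "weighted_path_count n e (a # as) c =
      (\<Sum>i | i < n \<and> a < e i \<and> 0 < c i. c i * weighted_path_count n e as (c(i := c i - 1)))"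
    using summand by (auto simp: weighted_path_count_def [of n e "a # as"] sum_distrib_left intro!: sum.cong)
  also have "\<dots> = (\<Sum>i | i < n \<and> a < e i. c i * weighted_path_count n e as (c(i := c i - 1)))"
    by (rule sum.mono_neutral_left) auto
  finally show ?thesis .
qed

definition score :: "'q set \<Rightarrow> ('q \<Rightarrow> nat) \<Rightarrow> nat \<Rightarrow> nat" where
  "score Q f i = card {q \<in> Q. f q = i}"

text \<open>The factor c i counts the positions q with f q = i, and removing any one of them changes
  the score in the same way. So the sum over indices becomes a sum over positions, which is the
  product rule.\<close>

lemma weighted_path_count_score_Cons:
  assumes Q: "finite Q" "\<And>q. q \<in> Q \<Longrightarrow> f q < n"
  shows "weighted_path_count n e (a # as) (score Q f) =
    (\<Sum>q\<in>Q. if a < e (f q) then weighted_path_count n e as (score (Q - {q}) f) else 0)"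
proof -
  let ?W = "weighted_path_count n e as"
  have remove: "score (Q - {q}) f = (score Q f)(f q := score Q f (f q) - 1)" if "q \<in> Q" for q
  proof
    fix i
    have "{p \<in> Q - {q}. f p = i} = {p \<in> Q. f p = i} - (if f q = i then {q} else {})" by auto
    then show "score (Q - {q}) f i = ((score Q f)(f q := score Q f (f q) - 1)) i"
      using Q(1) that by (auto simp: score_def)
  qed
  have "weighted_path_count n e (a # as) (score Q f) =
      (\<Sum>i | i < n \<and> a < e i. \<Sum>q\<in>{q \<in> {q \<in> Q. a < e (f q)}. f q = i}. ?W (score (Q - {q}) f))"
    unfolding weighted_path_count_Cons
  proof (rule sum.cong [OF refl])
    fix i assume i: "i \<in> {i. i < n \<and> a < e i}"
    then have "{q \<in> {q \<in> Q. a < e (f q)}. f q = i} = {q \<in> Q. f q = i}" by auto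
    moreover have "(\<Sum>q | q \<in> Q \<and> f q = i. ?W (score (Q - {q}) f)) =
        (\<Sum>q | q \<in> Q \<and> f q = i. ?W ((score Q f)(i := score Q f i - 1)))"
      by (intro sum.cong) (auto simp: remove)
    ultimately show "score Q f i * ?W ((score Q f)(i := score Q f i - 1)) =
        (\<Sum>q\<in>{q \<in> {q \<in> Q. a < e (f q)}. f q = i}. ?W (score (Q - {q}) f))"
      by (simp add: score_def)
  qed
  also have "\<dots> = (\<Sum>q | q \<in> Q \<and> a < e (f q). ?W (score (Q - {q}) f))"
    using Q by (intro sum.group) auto
  also have "\<dots> = (\<Sum>q\<in>Q. if a < e (f q) then ?W (score (Q - {q}) f) else 0)"
    using Q(1) by (simp add: sum.inter_filter)
  finally show ?thesis .
qed

text \<open>The coefficient of x v in the factor x j - x i of the cell q = (i, j), for v = i or v =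
  j.\<close>

definition choice_sign :: "nat \<times> nat \<Rightarrow> nat \<Rightarrow> int" where
  "choice_sign q v = (if v = snd q then 1 else - 1)"

lemma sum_PiE_remove:
  assumes "finite Q" "q \<in> Q"
  shows "(\<Sum>f\<in>PiE Q B. g (f q) (restrict f (Q - {q}))) = (\<Sum>v\<in>B q. \<Sum>h\<in>PiE (Q - {q}) B. g v h)"
proof -
  have Q: "PiE Q B = (\<lambda>(v, h). h(q := v)) ` (B q \<times> PiE (Q - {q}) B)"
    using PiE_insert_eq [of q "Q - {q}" B] assms(2) by (simp add: insert_absorb)
  have restr: "restrict (h(q := v)) (Q - {q}) = h" if "h \<in> PiE (Q - {q}) B" for h v
    using that by (auto simp: fun_eq_iff PiE_def extensional_def)
  have "(\<Sum>f\<in>PiE Q B. g (f q) (restrict f (Q - {q}))) =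
      (\<Sum>(v, h)\<in>B q \<times> PiE (Q - {q}) B. g v h)"
  proof -
    have "(\<Sum>f\<in>PiE Q B. g (f q) (restrict f (Q - {q}))) =
        sum ((\<lambda>f. g (f q) (restrict f (Q - {q}))) \<circ> (\<lambda>(v, h). h(q := v))) (B q \<times> PiE (Q - {q}) B)"
      unfolding Q by (rule sum.reindex [OF inj_combinator]) simp
    also have "\<dots> = (\<Sum>(v, h)\<in>B q \<times> PiE (Q - {q}) B. g v h)"
      by (intro sum.cong refl) (clarsimp simp: restr)
    finally show ?thesis .
  qed
  then show ?thesis by (simp add: sum.cartesian_product)
qed

text \<open>Each cell (i, j) contributes the factor x j - x i; a choice of one term in every factor
  yields a monomial with exponents given by the score of the choice.\<close>

lemma selberg_filling_count:
  assumes e: "strict_mono_on {..<n} e" and as: "set as \<inter> e ` {..<n} = {}"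
    and Q: "finite Q" "\<And>q. q \<in> Q \<Longrightarrow> fst q < snd q \<and> snd q < n"
  shows "int (filling_count (\<lambda>_ _. False) (e \<circ> fst) (e \<circ> snd) as Q) =
    (\<Sum>f\<in>PiE Q (\<lambda>q. {fst q, snd q}).
       (\<Prod>q\<in>Q. choice_sign q (f q)) * int (weighted_path_count n e as (score Q f)))"
  using as Q
proof (induction as arbitrary: Q)
  case Nil
  show ?case
  proof (cases "Q = {}")
    case True
    then show ?thesis by (simp add: weighted_path_count_def score_def)
  next
    case False
    then obtain q where q: "q \<in> Q" by blast
    have "weighted_path_count n e [] (score Q f) = 0" if "f \<in> PiE Q (\<lambda>q. {fst q, snd q})" for f
    proof -
      have "f q \<in> {fst q, snd q}" using that q by (rule PiE_mem)
      then have "f q < n" using Nil.prems(3) [OF q] by auto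
      moreover have "{p \<in> Q. f p = f q} \<noteq> {}" using q by blast
      then have "score Q f (f q) \<noteq> 0"
        using Nil.prems(2) by (simp add: score_def del: Collect_empty_eq)
      ultimately show ?thesis by (auto simp: weighted_path_count_def)
    qed
    then show ?thesis using False by simp
  qed
next
  case (Cons a as)
  let ?B = "\<lambda>q::nat \<times> nat. {fst q, snd q}"
  let ?sg = "\<lambda>Q f. \<Prod>q\<in>Q. choice_sign q (f q)"
  let ?W = "weighted_path_count n e as"
  let ?S = "\<lambda>Q. \<Sum>f\<in>PiE Q ?B. ?sg Q f * int (?W (score Q f))"
  let ?k = "\<lambda>q. \<Sum>v\<in>?B q. (if a < e v then choice_sign q v else 0)"
  have e_less: "e i < e j" if "i < j" "j < n" for i j
    using strict_mono_onD [OF e] that by simp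
  \<comment> \<open>The two signed terms add up to [a < e j] - [a < e i]: they cancel if a lies
    below both diagonal entries, and e i < e j excludes the value -1.\<close>
  have k: "?k q = (if e (fst q) < a \<and> a < e (snd q) then 1 else 0)" if "q \<in> Q" for q
  proof -
    have "fst q < snd q" "snd q < n" using Cons.prems(3) that by auto
    moreover from this have "a \<noteq> e (fst q)" "a \<noteq> e (snd q)" "e (fst q) < e (snd q)"
      using Cons.prems(1) e_less by auto
    ultimately show ?thesis by (auto simp: choice_sign_def)
  qed
  have factor: "(\<Sum>f\<in>PiE Q ?B. if a < e (f q) then ?sg Q f * int (?W (score (Q - {q}) f)) else 0) =
      ?k q * ?S (Q - {q})" if q: "q \<in> Q" for q
  proof -
    have "(\<Sum>f\<in>PiE Q ?B. if a < e (f q) then ?sg Q f * int (?W (score (Q - {q}) f)) else 0) =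
        (\<Sum>f\<in>PiE Q ?B. (if a < e (f q) then choice_sign q (f q) else 0) *
          (?sg (Q - {q}) (restrict f (Q - {q})) * int (?W (score (Q - {q}) (restrict f (Q - {q}))))))"
    proof (rule sum.cong [OF refl])
      fix f
      have "score (Q - {q}) (restrict f (Q - {q})) = score (Q - {q}) f"
        by (auto simp: score_def fun_eq_iff intro!: arg_cong [where f = card])
      moreover have "?sg Q f = choice_sign q (f q) * ?sg (Q - {q}) (restrict f (Q - {q}))"
        using q Cons.prems(2) by (simp add: prod.remove [of Q q])
      ultimately show "(if a < e (f q) then ?sg Q f * int (?W (score (Q - {q}) f)) else 0) =
          (if a < e (f q) then choice_sign q (f q) else 0) *
          (?sg (Q - {q}) (restrict f (Q - {q})) * int (?W (score (Q - {q}) (restrict f (Q - {q})))))"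
        by simp
    qed
    also have "\<dots> = (\<Sum>v\<in>?B q. \<Sum>h\<in>PiE (Q - {q}) ?B.
        (if a < e v then choice_sign q v else 0) * (?sg (Q - {q}) h * int (?W (score (Q - {q}) h))))"
      by (rule sum_PiE_remove [OF Cons.prems(2) q])
    also have "\<dots> = ?k q * ?S (Q - {q})"
      by (simp only: sum_product)
    finally show ?thesis .
  qed
  have "int (filling_count (\<lambda>_ _. False) (e \<circ> fst) (e \<circ> snd) (a # as) Q) =
      (\<Sum>q | q \<in> Q \<and> e (fst q) < a \<and> a < e (snd q). ?S (Q - {q}))"
  proof -
    have "int (filling_count (\<lambda>_ _. False) (e \<circ> fst) (e \<circ> snd) as (Q - {q})) = ?S (Q - {q})" for q
      by (rule Cons.IH) (use Cons.prems in auto)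
    then show ?thesis by simp
  qed
  also have "\<dots> = (\<Sum>q\<in>Q. if e (fst q) < a \<and> a < e (snd q) then ?S (Q - {q}) else 0)"
    using Cons.prems(2) by (simp only: sum.inter_filter)
  also have "\<dots> = (\<Sum>q\<in>Q. ?k q * ?S (Q - {q}))"
    by (rule sum.cong [OF refl]) (simp only: k, simp)
  also have "\<dots> = (\<Sum>q\<in>Q. \<Sum>f\<in>PiE Q ?B.
      if a < e (f q) then ?sg Q f * int (?W (score (Q - {q}) f)) else 0)"
    by (rule sum.cong [OF refl]) (simp only: factor)
  also have "\<dots> = (\<Sum>f\<in>PiE Q ?B. \<Sum>q\<in>Q.
      if a < e (f q) then ?sg Q f * int (?W (score (Q - {q}) f)) else 0)"
    by (rule sum.swap)
  also have "\<dots> = (\<Sum>f\<in>PiE Q ?B. ?sg Q f * int (weighted_path_count n e (a # as) (score Q f)))"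
  proof (rule sum.cong [OF refl])
    fix f assume f: "f \<in> PiE Q ?B"
    have "f q < n" if "q \<in> Q" for q
      using PiE_mem [OF f that] Cons.prems(3) [OF that] by auto
    then have "int (weighted_path_count n e (a # as) (score Q f)) =
        (\<Sum>q\<in>Q. if a < e (f q) then int (?W (score (Q - {q}) f)) else 0)"
      using Cons.prems(2) by (subst weighted_path_count_score_Cons) (auto intro!: sum.cong)
    then show "(\<Sum>q\<in>Q. if a < e (f q) then ?sg Q f * int (?W (score (Q - {q}) f)) else 0) =
        ?sg Q f * int (weighted_path_count n e (a # as) (score Q f))"
      by (simp add: sum_distrib_left if_distrib cong: if_cong)
  qed
  finally show ?case .
qed

section \<open>The ratio of the two counts for a single page\<close>

definition page_cells :: "nat \<Rightarrow> (nat \<times> nat) set" where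
  "page_cells n = {(i, j). i < j \<and> j < n}"

lemma finite_page_cells: "finite (page_cells n)"
  by (rule finite_subset [of _ "{..<n} \<times> {..<n}"]) (auto simp: page_cells_def)

lemma prod_single:
  fixes u :: "'q \<Rightarrow> 'a::comm_semiring_1" and k :: "'q \<Rightarrow> 'k::comm_monoid_add"
  shows "(\<Prod>q\<in>Q. Poly_Mapping.single (k q) (u q)) = Poly_Mapping.single (\<Sum>q\<in>Q. k q) (\<Prod>q\<in>Q. u q)"
  by (induction Q rule: infinite_finite_induct) (auto simp: mult_single)

text \<open>The Vandermonde identity is taken at indeterminates X i, where both sides expand into
  monomials and F is applied to the exponent vectors. The vector of p is cut off at n because p
  fixes every i >= n, where the exponent is 0.\<close>

lemma Vandermonde_functional:
  fixes F :: "(nat \<Rightarrow> nat) \<Rightarrow> int"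
  shows "(\<Sum>f\<in>PiE (page_cells n) (\<lambda>q. {fst q, snd q}).
      (\<Prod>q\<in>page_cells n. choice_sign q (f q)) * F (score (page_cells n) f)) =
    (\<Sum>p | p permutes {0..<n}. sign p * F (\<lambda>i. if i < n then p i else 0))"
proof -
  let ?Q = "page_cells n" and ?B = "\<lambda>q::nat \<times> nat. {fst q, snd q}"
  define X :: "nat \<Rightarrow> (nat \<Rightarrow>\<^sub>0 nat) \<Rightarrow>\<^sub>0 int"
    where "X i = Poly_Mapping.single (Poly_Mapping.single i 1) 1" for i
  define cf where "cf f = (\<Sum>q\<in>?Q. Poly_Mapping.single (f q) (1::nat))" for f :: "nat \<times> nat \<Rightarrow> nat"
  define cp where "cp p = (\<Sum>i = 0..<n. Poly_Mapping.single i (p i))" for p :: "nat \<Rightarrow> nat"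
  have X_power: "X i ^ k = Poly_Mapping.single (Poly_Mapping.single i k) 1" for i k
    by (induction k) (auto simp: X_def mult_single single_add [symmetric])
  have factor: "X (snd q) - X (fst q) =
      (\<Sum>v\<in>?B q. Poly_Mapping.single (Poly_Mapping.single v 1) (choice_sign q v))" if "q \<in> ?Q" for q
    using that by (auto simp: page_cells_def choice_sign_def X_def single_uminus)
  have pairs: "?Q = (\<lambda>(j, i). (i, j)) ` (SIGMA j:{0..<n}. {..<j})"
    by (auto simp: page_cells_def)
  have "(\<Prod>j = 0..<n. \<Prod>i<j. X j - X i) = (\<Prod>q\<in>?Q. X (snd q) - X (fst q))"
    unfolding pairs by (subst prod.reindex) (auto simp: inj_on_def prod.Sigma split_def)
  also have "\<dots> = (\<Prod>q\<in>?Q. \<Sum>v\<in>?B q. Poly_Mapping.single (Poly_Mapping.single v 1) (choice_sign q v))"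
    using factor by simp
  also have "\<dots> = (\<Sum>f\<in>PiE ?Q ?B. Poly_Mapping.single (cf f) (\<Prod>q\<in>?Q. choice_sign q (f q)))"
    by (subst prod_sum_PiE) (auto simp: finite_page_cells prod_single cf_def)
  finally have lhs: "(\<Prod>j = 0..<n. \<Prod>i<j. X j - X i) = \<dots>" .
  have "(\<Sum>p | p permutes {0..<n}. signof p * (\<Prod>i = 0..<n. X i ^ p i)) =
      (\<Sum>p | p permutes {0..<n}. Poly_Mapping.single (cp p) (sign p))"
    by (simp add: X_power prod_single cp_def single_of_int [symmetric] mult_single del: single_of_int)
  then have eq: "(\<Sum>f\<in>PiE ?Q ?B. Poly_Mapping.single (cf f) (\<Prod>q\<in>?Q. choice_sign q (f q))) =
      (\<Sum>p | p permutes {0..<n}. Poly_Mapping.single (cp p) (sign p))"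
    using lhs Vandermonde_permutation_sum [of X n] by simp
  have cf: "Poly_Mapping.lookup (cf f) = score ?Q f" for f
    by (auto simp: fun_eq_iff cf_def score_def Poly_Mapping.lookup_sum lookup_single when_def
      sum.inter_filter [symmetric] finite_page_cells)
  have cp: "Poly_Mapping.lookup (cp p) = (\<lambda>i. if i < n then p i else 0)" for p
    by (auto simp: fun_eq_iff cp_def Poly_Mapping.lookup_sum lookup_single when_def)
  show ?thesis
    using sum_single_eq_imp_functional_eq [OF _ _ eq, where F = "\<lambda>k. F (Poly_Mapping.lookup k)"]
    by (simp add: cf cp finite_PiE finite_page_cells finite_permutations)
qed

text \<open>Permuting the exponents keeps the product of their factorials, which therefore leaves
  the alternating sum. What remains is the Young sum of the empty page: threshold 0, and c =
  \<open>id\<close> because column j has j off-diagonal cells.\<close>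

lemma selberg_young_filling_count:
  assumes e: "strict_mono_on {..<n} e" and as: "sorted_wrt (<) as" "set as \<inter> e ` {..<n} = {}"
  shows "filling_count (\<lambda>_ _. False) (e \<circ> fst) (e \<circ> snd) as (page_cells n) =
    (\<Prod>i<n. fact i) * filling_count young_less (e \<circ> fst) (e \<circ> snd) as (page_cells n)"
proof -
  have cells: "page_cells n = lower_cells n id"
    by (auto simp: page_cells_def lower_cells_def)
  have "int (filling_count (\<lambda>_ _. False) (e \<circ> fst) (e \<circ> snd) as (page_cells n)) =
      (\<Sum>p | p permutes {0..<n}. sign p *
        int (weighted_path_count n e as (\<lambda>i. if i < n then p i else 0)))"
    using Vandermonde_functional [of n "\<lambda>c. int (weighted_path_count n e as c)"]
    by (subst selberg_filling_count [OF e as(2) finite_page_cells]) (auto simp: page_cells_def)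
  also have "\<dots> = (\<Sum>p | p permutes {0..<n}. int (\<Prod>i<n. fact i) * (sign p * int (path_count n e as (id \<circ> p))))"
  proof (rule sum.cong [OF refl])
    fix p assume "p \<in> {p. p permutes {0..<n}}"
    then have p: "p permutes {..<n}" by (simp add: atLeast0LessThan)
    have "(\<Prod>i<n. fact (p i)) = (\<Prod>i<n. fact i :: nat)"
      using prod.permute [OF p, of "fact :: nat \<Rightarrow> nat"] by (simp add: comp_def)
    moreover have "weighted_path_count n e as (\<lambda>i. if i < n then p i else 0) = weighted_path_count n e as p"
      by (rule weighted_path_count_cong) simp
    ultimately show "sign p * int (weighted_path_count n e as (\<lambda>i. if i < n then p i else 0)) =
        int (\<Prod>i<n. fact i) * (sign p * int (path_count n e as (id \<circ> p)))"
      by (simp add: weighted_path_count_def)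
  qed
  also have "\<dots> = int (\<Prod>i<n. fact i) * alternating_path_count n e as 0 id"
    by (simp add: alternating_path_count_def sum_distrib_left)
  also have "alternating_path_count n e as 0 id =
      int (filling_count young_less (e \<circ> fst) (e \<circ> snd) as (page_cells n))"
    unfolding cells by (rule young_filling_count [OF e as, symmetric]) (auto simp: strict_mono_on_def)
  finally show ?thesis
    by (metis of_nat_eq_iff of_nat_mult)
qed

section \<open>From pages to books\<close>

text \<open>Counting on a page uses indices from 0, so that column j has j off-diagonal cells; books
  count from 1.\<close>

definition off_cell :: "nat \<Rightarrow> nat \<times> nat \<Rightarrow> cell" where
  "off_cell k q = Off k (Suc (fst q)) (Suc (snd q))"

definition young_page :: "nat \<Rightarrow> nat \<Rightarrow> (cell \<Rightarrow> nat) \<Rightarrow> bool" where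
  "young_page n k T \<longleftrightarrow> (\<forall>p\<in>page_cells n. \<forall>q\<in>page_cells n.
     young_less p q \<longrightarrow> T (off_cell k p) < T (off_cell k q))"

lemma inj_off_cell: "inj_on (off_cell k) Q"
  by (auto simp: inj_on_def off_cell_def prod_eq_iff)

lemma off_cell_image_page_cells:
  "off_cell k ` page_cells n = {Off k i j | i j. 1 \<le> i \<and> i < j \<and> j \<le> n}"
proof (intro Set.set_eqI iffI)
  fix c assume "c \<in> {Off k i j | i j. 1 \<le> i \<and> i < j \<and> j \<le> n}"
  then obtain i j where "c = Off k i j" "1 \<le> i" "i < j" "j \<le> n" by blast
  then show "c \<in> off_cell k ` page_cells n"
    by (intro image_eqI [of _ _ "(i - 1, j - 1)"]) (auto simp: off_cell_def page_cells_def)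
qed (auto simp: off_cell_def page_cells_def)

lemma selberg_book_iff:
  "selberg_book n m T \<longleftrightarrow> bij_betw T (book_cells n m) {1..n + m * (n choose 2)} \<and>
     (\<forall>c. c \<notin> book_cells n m \<longrightarrow> T c = 0) \<and>
     (\<forall>k\<in>{1..m}. \<forall>q\<in>page_cells n.
        T (Diag (Suc (fst q))) < T (off_cell k q) \<and> T (off_cell k q) < T (Diag (Suc (snd q))))"
proof -
  have "(\<forall>k i j. 1 \<le> k \<and> k \<le> m \<and> 1 \<le> i \<and> i < j \<and> j \<le> n \<longrightarrow>
        T (Diag i) < T (Off k i j) \<and> T (Off k i j) < T (Diag j)) \<longleftrightarrow>
      (\<forall>k\<in>{1..m}. \<forall>q\<in>page_cells n.
        T (Diag (Suc (fst q))) < T (off_cell k q) \<and> T (off_cell k q) < T (Diag (Suc (snd q))))"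
    (is "?L \<longleftrightarrow> ?R")
  proof
    assume R: ?R
    show ?L
    proof (intro allI impI)
      fix k i j :: nat assume *: "1 \<le> k \<and> k \<le> m \<and> 1 \<le> i \<and> i < j \<and> j \<le> n"
      then have "(i - 1, j - 1) \<in> page_cells n" by (auto simp: page_cells_def)
      then show "T (Diag i) < T (Off k i j) \<and> T (Off k i j) < T (Diag j)"
        using R * by (force simp: off_cell_def)
    qed
  qed (auto simp: page_cells_def off_cell_def)
  then show ?thesis by (simp add: selberg_book_def)
qed

text \<open>Row and column comparisons that involve a diagonal cell already follow from the Selberg
  bounds; the others are those of \<open>young_page\<close>.\<close>

lemma young_book_iff:
  "young_book n m T \<longleftrightarrow> selberg_book n m T \<and> (\<forall>k\<in>{1..m}. young_page n k T)"
proof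
  assume Y: "young_book n m T"
  then have row: "\<And>k i j j'. 1 \<le> k \<Longrightarrow> k \<le> m \<Longrightarrow> 1 \<le> i \<Longrightarrow> i \<le> j \<Longrightarrow> j < j' \<Longrightarrow> j' \<le> n \<Longrightarrow>
        page_entry T k i j < page_entry T k i j'"
    and column: "\<And>k i i' j. 1 \<le> k \<Longrightarrow> k \<le> m \<Longrightarrow> 1 \<le> i \<Longrightarrow> i < i' \<Longrightarrow> i' \<le> j \<Longrightarrow> j \<le> n \<Longrightarrow>
        page_entry T k i j < page_entry T k i' j"
    by (auto simp: young_book_def)
  have "T (off_cell k p) < T (off_cell k q)"
    if "k \<in> {1..m}" "p \<in> page_cells n" "q \<in> page_cells n" "young_less p q" for k p q
    using that row [of k "Suc (fst p)" "Suc (snd p)" "Suc (snd q)"]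
      column [of k "Suc (fst p)" "Suc (fst q)" "Suc (snd p)"]
    by (auto simp: young_less_def page_cells_def off_cell_def page_entry_def)
  then show "selberg_book n m T \<and> (\<forall>k\<in>{1..m}. young_page n k T)"
    using Y by (auto simp: young_book_def young_page_def)
next
  assume S: "selberg_book n m T \<and> (\<forall>k\<in>{1..m}. young_page n k T)"
  then have between: "\<And>k i j. 1 \<le> k \<Longrightarrow> k \<le> m \<Longrightarrow> 1 \<le> i \<Longrightarrow> i < j \<Longrightarrow> j \<le> n \<Longrightarrow>
      T (Diag i) < T (Off k i j) \<and> T (Off k i j) < T (Diag j)"
    by (auto simp: selberg_book_def)
  have page: "T (Off k i j) < T (Off k i' j')"
    if "k \<in> {1..m}" "1 \<le> i" "i < j" "j \<le> n" "1 \<le> i'" "i' < j'" "j' \<le> n"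
      "i = i' \<and> j < j' \<or> j = j' \<and> i < i'" for k i j i' j'
  proof -
    have "(i - 1, j - 1) \<in> page_cells n" "(i' - 1, j' - 1) \<in> page_cells n"
      "young_less (i - 1, j - 1) (i' - 1, j' - 1)"
      using that by (auto simp: page_cells_def young_less_def)
    then have "T (off_cell k (i - 1, j - 1)) < T (off_cell k (i' - 1, j' - 1))"
      using S that(1) unfolding young_page_def by blast
    then show ?thesis using that by (simp add: off_cell_def)
  qed
  have "page_entry T k i j < page_entry T k i j'"
    if "1 \<le> k" "k \<le> m" "1 \<le> i" "i \<le> j" "j < j'" "j' \<le> n" for k i j j'
    using that between [of k i j'] page [of k i j i j'] by (auto simp: page_entry_def)
  moreover have "page_entry T k i j < page_entry T k i' j"
    if "1 \<le> k" "k \<le> m" "1 \<le> i" "i < i'" "i' \<le> j" "j \<le> n" for k i i' j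
    using that between [of k i j] page [of k i j i' j] by (auto simp: page_entry_def)
  ultimately show "young_book n m T"
    using S by (auto simp: young_book_def)
qed

lemma finite_book_cells: "finite (book_cells n m)"
proof (rule finite_subset)
  show "book_cells n m \<subseteq> Diag ` {1..n} \<union> (\<Union>k\<in>{1..m}. off_cell k ` page_cells n)"
    unfolding book_cells_def off_cell_image_page_cells by auto
qed (simp add: finite_page_cells)

lemma finite_selberg_books: "finite {T. selberg_book n m T}"
proof (rule finite_subset)
  show "{T. selberg_book n m T} \<subseteq>
      {T. \<forall>c. (c \<in> book_cells n m \<longrightarrow> T c \<in> {1..n + m * (n choose 2)}) \<and>
        (c \<notin> book_cells n m \<longrightarrow> T c = 0)}"
    by (auto simp: selberg_book_def bij_betw_def)
qed (intro finite_set_of_finite_funs finite_book_cells finite_atLeastAtMost)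

lemma page_subset_book_cells:
  assumes "k \<in> {1..m}"
  shows "off_cell k ` page_cells n \<subseteq> book_cells n m"
  using assms unfolding off_cell_image_page_cells book_cells_def by auto

text \<open>Off P the two maps coincide, so there g is a bijection onto the complement of the image
  of P under f. It is one on all of S exactly when it maps P onto the part left over.\<close>

lemma bij_betw_restrict_swap:
  assumes f: "bij_betw f S B" and "P \<subseteq> S" and agree: "\<And>c. c \<in> S - P \<Longrightarrow> g c = f c"
  shows "bij_betw g S B \<longleftrightarrow> bij_betw g P (f ` P)"
proof -
  have rest: "bij_betw f (S - P) (B - f ` P)"
    using f assms(2) by (auto simp: bij_betw_def inj_on_def)
  have "bij_betw g (S - P) (B - f ` P) \<longleftrightarrow> bij_betw f (S - P) (B - f ` P)"
    by (rule bij_betw_cong) (rule agree)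
  then have rest': "bij_betw g (S - P) (B - f ` P)" using rest by simp
  have S: "S = P \<union> (S - P)" and B: "B = f ` P \<union> (B - f ` P)"
    using f assms(2) by (auto simp: bij_betw_def)
  show ?thesis
  proof
    assume g: "bij_betw g S B"
    have "g ` P = B - g ` (S - P)"
      using g assms(2) by (auto simp: bij_betw_def inj_on_def)
    also have "\<dots> = f ` P"
      using rest' B by (auto simp: bij_betw_def)
    finally show "bij_betw g P (f ` P)"
      using g assms(2) by (auto simp: bij_betw_def intro: inj_on_subset)
  next
    assume "bij_betw g P (f ` P)"
    then show "bij_betw g S B"
      using bij_betw_combine [OF _ rest'] S B by fastforce
  qed
qed

text \<open>The cells outside the page fix the diagonal entries and, by bijectivity, also the set of
  entries of the page. Hence bounds and entries can be read off T0.\<close>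

lemma selberg_books_fibre:
  assumes T0: "selberg_book n m T0" and k: "k \<in> {1..m}"
  defines "P \<equiv> off_cell k ` page_cells n"
  shows "{T. selberg_book n m T \<and> (\<forall>c. c \<notin> P \<longrightarrow> T c = T0 c)} =
    fillings (off_cell k) (\<lambda>_ _. False) ((\<lambda>i. T0 (Diag (Suc i))) \<circ> fst) ((\<lambda>i. T0 (Diag (Suc i))) \<circ> snd)
      T0 (page_cells n) (T0 ` P)"
proof -
  have P: "P \<subseteq> book_cells n m"
    using page_subset_book_cells [OF k] by (simp add: P_def)
  have diag: "Diag i \<notin> P" and other: "k' \<noteq> k \<Longrightarrow> off_cell k' q \<notin> P" for i k' q
    by (auto simp: P_def off_cell_def)
  have "selberg_book n m T \<longleftrightarrow> bij_betw (T \<circ> off_cell k) (page_cells n) (T0 ` P) \<and>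
      (\<forall>q\<in>page_cells n. T0 (Diag (Suc (fst q))) < T (off_cell k q) \<and>
        T (off_cell k q) < T0 (Diag (Suc (snd q))))"
    if agree: "\<forall>c. c \<notin> P \<longrightarrow> T c = T0 c" for T
  proof -
    have "bij_betw T (book_cells n m) {1..n + m * (n choose 2)} \<longleftrightarrow> bij_betw T P (T0 ` P)"
      using T0 P agree by (intro bij_betw_restrict_swap) (auto simp: selberg_book_def)
    also have "\<dots> \<longleftrightarrow> bij_betw (T \<circ> off_cell k) (page_cells n) (T0 ` P)"
      unfolding P_def using inj_off_cell by (intro bij_betw_comp_iff) (auto simp: bij_betw_def)
    finally have bij: "bij_betw T (book_cells n m) {1..n + m * (n choose 2)} \<longleftrightarrow>
        bij_betw (T \<circ> off_cell k) (page_cells n) (T0 ` P)" .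
    have zero: "T c = 0" if "c \<notin> book_cells n m" for c
      using T0 P agree that by (auto simp: selberg_book_def)
    have between: "T (Diag (Suc (fst q))) < T (off_cell k' q) \<and> T (off_cell k' q) < T (Diag (Suc (snd q)))"
      if "k' \<in> {1..m}" "k' \<noteq> k" "q \<in> page_cells n" for k' q
      using T0 that agree diag other unfolding selberg_book_iff by simp
    show ?thesis
      unfolding selberg_book_iff bij using zero between k agree diag by (metis (no_types, lifting))
  qed
  then show ?thesis
    unfolding fillings_def by (auto simp: P_def)
qed

lemma fillings_relation:
  "fillings \<iota> R lo hi T0 Q A = {T \<in> fillings \<iota> (\<lambda>_ _. False) lo hi T0 Q A.
     \<forall>p\<in>Q. \<forall>q\<in>Q. R p q \<longrightarrow> T (\<iota> p) < T (\<iota> q)}"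
  by (auto simp: fillings_def)

lemma card_selberg_young_fibre:
  assumes T0: "selberg_book n m T0" and k: "k \<in> {1..m}"
  defines "P \<equiv> off_cell k ` page_cells n"
  shows "card {T. selberg_book n m T \<and> (\<forall>c. c \<notin> P \<longrightarrow> T c = T0 c)} =
    (\<Prod>i<n. fact i) *
      card {T. selberg_book n m T \<and> (\<forall>c. c \<notin> P \<longrightarrow> T c = T0 c) \<and> young_page n k T}"
proof -
  define e where "e i = T0 (Diag (Suc i))" for i
  define as where "as = sorted_list_of_set (T0 ` P)"
  have as: "sorted_wrt (<) as" "set as = T0 ` P"
    by (auto simp: as_def P_def finite_page_cells)
  \<comment> \<open>For i < j the entry of page k in cell (i, j) lies between the two diagonal
    entries.\<close>
  have e: "strict_mono_on {..<n} e"
  proof (rule strict_mono_onI)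
    fix i j assume "i \<in> {..<n}" "j \<in> {..<n}" "i < j"
    then have "(i, j) \<in> page_cells n" by (simp add: page_cells_def)
    then show "e i < e j"
      using T0 k unfolding selberg_book_iff e_def by fastforce
  qed
  have "T0 c \<noteq> e i" if "c \<in> P" "i < n" for c i
  proof -
    have "inj_on T0 (book_cells n m)" using T0 by (auto simp: selberg_book_def bij_betw_def)
    moreover have "c \<in> book_cells n m" using page_subset_book_cells [OF k] that(1) by (auto simp: P_def)
    moreover have "Diag (Suc i) \<in> book_cells n m" using that(2) by (auto simp: book_cells_def)
    moreover have "c \<noteq> Diag (Suc i)" using that(1) by (auto simp: P_def off_cell_def)
    ultimately show ?thesis by (auto simp: e_def inj_on_def)
  qed
  then have disjoint: "set as \<inter> e ` {..<n} = {}" by (auto simp: as)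
  have fibre: "{T. selberg_book n m T \<and> (\<forall>c. c \<notin> P \<longrightarrow> T c = T0 c)} =
      fillings (off_cell k) (\<lambda>_ _. False) (e \<circ> fst) (e \<circ> snd) T0 (page_cells n) (set as)"
    using selberg_books_fibre [OF T0 k] by (simp add: as P_def e_def [abs_def])
  have young_fibre: "{T. selberg_book n m T \<and> (\<forall>c. c \<notin> P \<longrightarrow> T c = T0 c) \<and> young_page n k T} =
      fillings (off_cell k) young_less (e \<circ> fst) (e \<circ> snd) T0 (page_cells n) (set as)"
    unfolding fillings_relation [of _ young_less] fibre [symmetric] by (auto simp: young_page_def)
  show ?thesis
    unfolding fibre young_fibre
    by (subst (1 2) card_fillings [OF finite_page_cells inj_off_cell as(1)])
      (auto simp: young_less_def intro: selberg_young_filling_count [OF e as(1) disjoint])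
qed

section \<open>Passing from Selberg to Young books one page at a time\<close>

lemma card_fibres:
  assumes "finite H" "finite R" "f ` H \<subseteq> R"
  shows "card H = (\<Sum>r\<in>R. card {T \<in> H. f T = r})"
  using sum.group [OF assms, of "\<lambda>_. 1::nat"] by simp

text \<open>Interpolates between Selberg books (p = 0) and Young books (p = m). D will be the gap
  condition or constantly true.\<close>

definition partly_young_books ::
  "nat \<Rightarrow> nat \<Rightarrow> ((cell \<Rightarrow> nat) \<Rightarrow> bool) \<Rightarrow> nat \<Rightarrow> (cell \<Rightarrow> nat) set" where
  "partly_young_books n m D p = {T. selberg_book n m T \<and> D T \<and> (\<forall>k\<in>{1..p}. young_page n k T)}"

text \<open>Books that agree outside page p + 1 share the diagonal and the pages 1, ..., p, so D and
  the conditions imposed so far are constant on each such class. Each class meeting them is a fibre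
  as in \<open>card_selberg_young_fibre\<close>, with the same ratio.\<close>

lemma card_partly_young_books_Suc:
  assumes D: "\<And>T T'. (\<And>i. T (Diag i) = T' (Diag i)) \<Longrightarrow> D T = D T'" and p: "p < m"
  shows "card (partly_young_books n m D p) =
    (\<Prod>i<n. fact i) * card (partly_young_books n m D (Suc p))"
proof -
  define P where "P = off_cell (Suc p) ` page_cells n"
  define \<phi> where "\<phi> T c = (if c \<in> P then 0 else T c)" for T :: "cell \<Rightarrow> nat" and c
  let ?H = "partly_young_books n m D"
  have \<phi>: "\<phi> T = \<phi> T' \<longleftrightarrow> (\<forall>c. c \<notin> P \<longrightarrow> T c = T' c)" for T T'
    by (auto simp: \<phi>_def fun_eq_iff)
  have fin: "finite (?H q)" for q
    by (rule finite_subset [OF _ finite_selberg_books]) (auto simp: partly_young_books_def)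
  have sub: "?H (Suc p) \<subseteq> ?H p" by (auto simp: partly_young_books_def)
  have fibre: "card {T \<in> ?H p. \<phi> T = r} = (\<Prod>i<n. fact i) * card {T \<in> ?H (Suc p). \<phi> T = r}"
    if r: "r \<in> \<phi> ` ?H p" for r
  proof -
    obtain T0 where T0: "T0 \<in> ?H p" "r = \<phi> T0" using r by blast
    have "D T \<and> (\<forall>k\<in>{1..p}. young_page n k T)" if agree: "\<forall>c. c \<notin> P \<longrightarrow> T c = T0 c" for T
    proof -
      have "T (Diag i) = T0 (Diag i)" for i
        using agree by (auto simp: P_def off_cell_def)
      moreover have "T (off_cell k q) = T0 (off_cell k q)" if "k \<in> {1..p}" for k q
      proof -
        have "off_cell k q \<notin> P" using that by (auto simp: P_def off_cell_def)
        then show ?thesis using agree by blast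
      qed
      moreover have "D T = D T0" by (rule D) fact
      ultimately show ?thesis
        using T0(1) by (simp add: partly_young_books_def young_page_def)
    qed
    then have "{T \<in> ?H p. \<phi> T = r} = {T. selberg_book n m T \<and> (\<forall>c. c \<notin> P \<longrightarrow> T c = T0 c)}"
      and "{T \<in> ?H (Suc p). \<phi> T = r} =
        {T. selberg_book n m T \<and> (\<forall>c. c \<notin> P \<longrightarrow> T c = T0 c) \<and> young_page n (Suc p) T}"
      by (auto simp: partly_young_books_def T0(2) \<phi> atLeastAtMostSuc_conv)
    then show ?thesis
      using card_selberg_young_fibre [of n m T0 "Suc p"] T0(1) p
      by (simp add: partly_young_books_def P_def)
  qed
  have "card (?H p) = (\<Sum>r\<in>\<phi> ` ?H p. card {T \<in> ?H p. \<phi> T = r})"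
    by (rule card_fibres) (use fin in auto)
  also have "\<dots> = (\<Prod>i<n. fact i) * (\<Sum>r\<in>\<phi> ` ?H p. card {T \<in> ?H (Suc p). \<phi> T = r})"
    by (simp add: fibre sum_distrib_left)
  also have "(\<Sum>r\<in>\<phi> ` ?H p. card {T \<in> ?H (Suc p). \<phi> T = r}) = card (?H (Suc p))"
    by (rule card_fibres [symmetric]) (use fin sub in auto)
  finally show ?thesis .
qed

lemma card_selberg_young_books:
  assumes "\<And>T T'. (\<And>i. T (Diag i) = T' (Diag i)) \<Longrightarrow> D T = D T'"
  shows "card {T \<in> SB n m. D T} = (\<Prod>i<n. fact i) ^ m * card {T \<in> YB n m. D T}"
proof -
  have "card (partly_young_books n m D 0) = (\<Prod>i<n. fact i) ^ p * card (partly_young_books n m D p)"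
    if "p \<le> m" for p
    using that
  proof (induction p)
    case (Suc p)
    have "card (partly_young_books n m D p) =
        (\<Prod>i<n. fact i) * card (partly_young_books n m D (Suc p))"
      by (rule card_partly_young_books_Suc) (use assms Suc.prems in blast, use Suc.prems in simp)
    then show ?case using Suc by simp
  qed simp
  moreover have "partly_young_books n m D 0 = {T \<in> SB n m. D T}"
    "partly_young_books n m D m = {T \<in> YB n m. D T}"
    by (auto simp: partly_young_books_def SB_def YB_def young_book_iff)
  ultimately show ?thesis by (metis order_refl)
qed

theorem theorem3p5:
  fixes n m :: nat
  assumes "n > 0" and "m > 0"
  shows "(\<forall>d :: nat \<Rightarrow> nat.
            card (SBd n m d) = (\<Prod>i = 1..n - 1. fact i) ^ m * card (YBd n m d))
         \<and> card (SB n m) = (\<Prod>i = 1..n - 1. fact i) ^ m * card (YB n m)"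
proof -
  \<comment> \<open>Index 0 contributes only 0! = 1.\<close>
  have "{..<n} = insert 0 {1..n - 1}" using assms(1) by auto
  then have "(\<Prod>i<n. fact i :: nat) = (\<Prod>i = 1..n - 1. fact i)" by simp
  then show ?thesis
    using card_selberg_young_books [of "diag_gaps_are n d" n m for d]
      card_selberg_young_books [of "\<lambda>_. True" n m]
    by (simp add: SBd_def YBd_def diag_gaps_are_def)
qed

end
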